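(* Let $P,Q$ be finite ranked posets with least and greatest elements. The set $\mathrm{Quilts}(P,Q)$, partially ordered by $f\le g$ iff $f(x,y)\le g(x,y)$ for all $x\in P$, $y\in Q$, is a distributive lattice, ranked by the function $$\operatorname{quiltrank} f=\sum_{x\in P,\,y\in Q}f(x,y)-\sum_{x\in P,\,y\in Q}f_{\hat 0}(x,y),$$ where $f_{\hat 0}(x,y)=\max\{0,\operatorname{rank}x+\operatorname{rank}y-\max\{\operatorname{rank}P,\operatorname{rank}Q\}\}$ is the least element of $\mathrm{Quilts}(P,Q)$. The greatest element of $\mathrm{Quilts}(P,Q)$ is $f_{\hat 1}(x,y)=\min\{\operatorname{rank}x,\operatorname{rank}y\}$.
   Context: $\mathbb N=\{0,1,2,\dots\}$. A poset is ranked if all its maximal chains have the same size. $x\lessdot y$ means $y$ covers $x$. For a finite ranked poset with least element $\hat 0$ and greatest element $\hat 1$, the rank function satisfies $\operatorname{rank}\hat 0=0$ and $\operatorname{rank}y=\operatorname{rank}x+1$ if $x\lessdot y$; $\operatorname{rank}P=\operatorname{rank}\hat 1_P$. "Ranked by $\operatorname{quiltrank}$" means that $\operatorname{quiltrank}$ is the rank function: it is $0$ on the least element and increases by exactly $1$ along each cover relation. $P\times Q$ carries the product order. A quilt of type $(P,Q)$ is a map $f:P\times Q\to\mathbb N$ such that: (i) $f(x,y)=0$ whenever $x=\hat 0_P$ or $y=\hat 0_Q$; (ii) $f(\hat 1_P,\hat 1_Q)=\min\{\operatorname{rank}P,\operatorname{rank}Q\}$; (iii) if $(x,y)\lessdot(x',y')$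 in $P\times Q$, then $f(x',y')\in\{f(x,y),f(x,y)+1\}$. $\mathrm{Quilts}(P,Q)$ is the set of all quilts of type $(P,Q)$. *)

theory Defs
  imports "HOL-Algebra.Lattice"
begin

definition covers :: "('a, 'm) gorder_scheme \<Rightarrow> 'a \<Rightarrow> 'a \<Rightarrow> bool"
  where "covers L x y \<longleftrightarrow>
    x \<in> carrier L \<and> y \<in> carrier L \<and> x \<sqsubset>\<^bsub>L\<^esub> y \<and>
    \<not> (\<exists>z\<in>carrier L. x \<sqsubset>\<^bsub>L\<^esub> z \<and> z \<sqsubset>\<^bsub>L\<^esub> y)"

text \<open>Since \<^const>\<open>card\<close> vanishes on infinite sets, the following is the intended notion
  only for finite posets; it is used in conjunction with finiteness throughout.\<close>

definition ranked :: "('a, 'm) gorder_scheme \<Rightarrow> bool"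
  where "ranked L \<longleftrightarrow>
    (\<forall>C D. pred_on.maxchain (carrier L) (\<sqsubset>\<^bsub>L\<^esub>) C \<longrightarrow> pred_on.maxchain (carrier L) (\<sqsubset>\<^bsub>L\<^esub>) D
      \<longrightarrow> card C = card D)"

locale finite_bounded_ranked_poset =
  partial_order L + weak_partial_order_bottom L + weak_partial_order_top L for L (structure) +
  assumes finite_carrier: "finite (carrier L)"
    and ranked: "ranked L"

definition is_rank_function :: "('a, 'm) gorder_scheme \<Rightarrow> ('a \<Rightarrow> 'n::semiring_1) \<Rightarrow> bool"
  where "is_rank_function L r \<longleftrightarrow>
    r \<bottom>\<^bsub>L\<^esub> = 0 \<and> (\<forall>x y. covers L x y \<longrightarrow> r y = r x + 1)"

text \<open>On a finite bounded ranked poset, a rank function exists and is unique on the carrier;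
  extensionality makes it unique as a total function.\<close>

definition rank :: "('a, 'm) gorder_scheme \<Rightarrow> 'a \<Rightarrow> nat"
  where "rank L = (THE r. r \<in> extensional (carrier L) \<and> is_rank_function L r)"

definition poset_rank :: "('a, 'm) gorder_scheme \<Rightarrow> nat"
  where "poset_rank L = rank L \<top>\<^bsub>L\<^esub>"

locale distributive_lattice = lattice L for L (structure) +
  assumes meet_join_distrib:
    "\<lbrakk>x \<in> carrier L; y \<in> carrier L; z \<in> carrier L\<rbrakk>
      \<Longrightarrow> x \<sqinter> (y \<squnion> z) = (x \<sqinter> y) \<squnion> (x \<sqinter> z)"

definition prod_poset ::
    "('a, 'm) gorder_scheme \<Rightarrow> ('b, 'n) gorder_scheme \<Rightarrow> ('a \<times> 'b) gorder"
  where "prod_poset P Q =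
    \<lparr>carrier = carrier P \<times> carrier Q, eq = (=),
     le = (\<lambda>(x, y) (x', y'). x \<sqsubseteq>\<^bsub>P\<^esub> x' \<and> y \<sqsubseteq>\<^bsub>Q\<^esub> y')\<rparr>"

text \<open>Maps \<open>P \<times> Q \<rightarrow> \<nat>\<close> are represented by extensional functions, so that two quilts are equal
  iff they agree on the carrier.\<close>

definition quilts ::
    "('a, 'm) gorder_scheme \<Rightarrow> ('b, 'n) gorder_scheme \<Rightarrow> ('a \<times> 'b \<Rightarrow> nat) set"
  where "quilts P Q = {f \<in> carrier P \<times> carrier Q \<rightarrow>\<^sub>E UNIV.
    (\<forall>x\<in>carrier P. \<forall>y\<in>carrier Q. x = \<bottom>\<^bsub>P\<^esub> \<or> y = \<bottom>\<^bsub>Q\<^esub> \<longrightarrow> f (x, y) = 0) \<and>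
    f (\<top>\<^bsub>P\<^esub>, \<top>\<^bsub>Q\<^esub>) = min (poset_rank P) (poset_rank Q) \<and>
    (\<forall>x y x' y'. covers (prod_poset P Q) (x, y) (x', y')
      \<longrightarrow> f (x', y') \<in> {f (x, y), f (x, y) + 1})}"

definition quilt_poset ::
    "('a, 'm) gorder_scheme \<Rightarrow> ('b, 'n) gorder_scheme \<Rightarrow> ('a \<times> 'b \<Rightarrow> nat) gorder"
  where "quilt_poset P Q =
    \<lparr>carrier = quilts P Q, eq = (=),
     le = (\<lambda>f g. \<forall>x\<in>carrier P. \<forall>y\<in>carrier Q. f (x, y) \<le> g (x, y))\<rparr>"

definition least_quilt ::
    "('a, 'm) gorder_scheme \<Rightarrow> ('b, 'n) gorder_scheme \<Rightarrow> 'a \<times> 'b \<Rightarrow> nat"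
  where "least_quilt P Q = (\<lambda>(x, y)\<in>carrier P \<times> carrier Q.
    nat (max 0 (int (rank P x) + int (rank Q y) - int (max (poset_rank P) (poset_rank Q)))))"

definition greatest_quilt ::
    "('a, 'm) gorder_scheme \<Rightarrow> ('b, 'n) gorder_scheme \<Rightarrow> 'a \<times> 'b \<Rightarrow> nat"
  where "greatest_quilt P Q = (\<lambda>(x, y)\<in>carrier P \<times> carrier Q. min (rank P x) (rank Q y))"

definition quiltrank ::
    "('a, 'm) gorder_scheme \<Rightarrow> ('b, 'n) gorder_scheme \<Rightarrow> ('a \<times> 'b \<Rightarrow> nat) \<Rightarrow> int"
  where "quiltrank P Q f =
    (\<Sum>x\<in>carrier P. \<Sum>y\<in>carrier Q. int (f (x, y))) -
    (\<Sum>x\<in>carrier P. \<Sum>y\<in>carrier Q. int (least_quilt P Q (x, y)))"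

end

theory Submission
  imports Defs
begin

text \<open>
  The quilt axioms survive pointwise maxima and minima, which gives the distributive lattice. A quilt
  grows by at most one per cover, so ascending from the bottom bounds it above and ascending to the
  top bounds it below. For the rank, if \<open>f < g\<close> are quilts then \<open>f\<close> can be raised by one at some
  point to a quilt still below \<open>g\<close>; hence a cover raises the sum of the values by exactly one, and
  the existence of such a rank function forces all maximal chains to have equal size.
\<close>

text \<open>Rankedness occurs in two opposite directions. For \<open>P\<close> and \<open>Q\<close>
  it is given, but \<open>rank\<close> is a definite description, so a rank function must first be
  built from the equality of chain sizes. For quilts it is the goal, so what they need about covers
  and chains is proved in a locale without it. The maximum in \<open>least_quilt\<close> comes from
  a minimum: the climb from \<open>(x, y)\<close> to the top gains at most
  \<open>(poset_rank P - rank P x) + (poset_rank Q - rank Q y)\<close> and must end at the smaller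
  poset rank, and sum minus minimum is maximum. The delicate step is the increment: raising
  \<open>f\<close> at an arbitrary point where \<open>f < g\<close> may break the unit steps at that
  point, so the point must be selected.\<close>

locale finite_bounded_poset =
  partial_order L + weak_partial_order_bottom L + weak_partial_order_top L for L (structure) +
  assumes finite_carrier: "finite (carrier L)"
begin

text \<open>As introduction rules these amount to transitivity and make the classical reasoner diverge.\<close>

declare le_cong_l [rule del] le_cong_r [rule del] weak_refl [rule del] weak_le_antisym [rule del]

lemma lless_iff: "x \<sqsubset> y \<longleftrightarrow> x \<sqsubseteq> y \<and> x \<noteq> y"
  by (simp add: lless_def eq_is_equal)

lemma antisym: "x \<sqsubseteq> y \<Longrightarrow> y \<sqsubseteq> x \<Longrightarrow> x \<in> carrier L \<Longrightarrow> y \<in> carrier L \<Longrightarrow> x = y"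
  using weak_le_antisym eq_is_equal by metis

lemma coversD:
  assumes "covers L x y"
  shows "x \<in> carrier L" "y \<in> carrier L" "x \<sqsubset> y" "x \<sqsubseteq> y" "x \<noteq> y"
  using assms by (auto simp: covers_def lless_iff)

lemma maximal_exists:
  assumes "S \<subseteq> carrier L" "S \<noteq> {}"
  obtains m where "m \<in> S" "\<And>z. z \<in> S \<Longrightarrow> \<not> m \<sqsubset> z"
proof -
  have "finite S"
    using assms(1) finite_carrier finite_subset by blast
  moreover have "transp_on S (\<sqsubset>)" "asymp_on S (\<sqsubset>)"
    using assms(1) by (auto intro!: transp_onI asymp_onI intro: lless_trans lless_antisym)
  ultimately obtain m where "m \<in> S" "\<forall>x\<in>S. x \<noteq> m \<longrightarrow> \<not> m \<sqsubset> x"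
    using Finite_Set.bex_max_element[of S "(\<sqsubset>)"] assms(2) by blast
  then show thesis
    using that lless_iff by metis
qed

text \<open>A maximal element among those above \<open>a\<close> and strictly below \<open>x\<close>
  is covered by \<open>x\<close>, since anything in between would be a larger candidate.\<close>

lemma lower_cover_above:
  assumes "a \<in> carrier L" "x \<in> carrier L" "a \<sqsubset> x"
  obtains y where "a \<sqsubseteq> y" "covers L y x"
proof -
  let ?S = "{y \<in> carrier L. a \<sqsubseteq> y \<and> y \<sqsubset> x}"
  obtain m where m: "m \<in> ?S" "\<And>z. z \<in> ?S \<Longrightarrow> \<not> m \<sqsubset> z"
    using maximal_exists[of ?S] assms by blast
  then have "covers L m x"
    using assms unfolding covers_def by (blast intro: le_trans dest: lless_imp_le)
  then show thesis
    using that m by blast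
qed

text \<open>In a finite carrier the number of elements strictly below \<open>x\<close> is a
  decreasing measure.\<close>

lemma below_induct [consumes 1, case_names step]:
  assumes "x \<in> carrier L"
    and step: "\<And>x. x \<in> carrier L \<Longrightarrow> (\<And>z. z \<in> carrier L \<Longrightarrow> z \<sqsubset> x \<Longrightarrow> P z) \<Longrightarrow> P x"
  shows "P x"
  using assms(1)
proof (induction "card {z \<in> carrier L. z \<sqsubset> x}" arbitrary: x rule: less_induct)
  case less
  show ?case
  proof (rule step[OF less.prems])
    fix z assume z: "z \<in> carrier L" "z \<sqsubset> x"
    have "{w \<in> carrier L. w \<sqsubset> z} \<subset> {w \<in> carrier L. w \<sqsubset> x}"
      using z less.prems lless_trans lless_iff by blast
    then have "card {w \<in> carrier L. w \<sqsubset> z} < card {w \<in> carrier L. w \<sqsubset> x}"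
      using finite_carrier by (intro psubset_card_mono) auto
    then show "P z"
      using less.hyps z by blast
  qed
qed

text \<open>Induction along covers from \<open>a\<close> up to \<open>x\<close> without constructing
  a chain: each descent goes to a lower cover still above \<open>a\<close>.\<close>

lemma cover_induct [consumes 3, case_names base step]:
  assumes "a \<in> carrier L" "x \<in> carrier L" "a \<sqsubseteq> x" and base: "P a"
    and step: "\<And>x y. covers L x y \<Longrightarrow> a \<sqsubseteq> x \<Longrightarrow> P x \<Longrightarrow> P y"
  shows "P x"
  using assms(2,3)
proof (induction x rule: below_induct)
  case (step x)
  show ?case
  proof (cases "a = x")
    case False
    then obtain y where "a \<sqsubseteq> y" "covers L y x"
      using lower_cover_above assms(1) step.hyps step.prems lless_iff by metis
    then show ?thesis
      using assms(5) step.IH coversD by blast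
  qed (use base in blast)
qed

lemma rank_function_unique:
  fixes r s :: "'a \<Rightarrow> 'n::semiring_1"
  assumes "is_rank_function L r" "is_rank_function L s" "x \<in> carrier L"
  shows "r x = s x"
  using bottom_closed assms(3) bottom_lower[OF assms(3)]
  by (induction x rule: cover_induct) (use assms(1,2) in \<open>auto simp: is_rank_function_def\<close>)

section \<open>Maximal chains measured by a rank function\<close>

lemma chain_iff:
  "pred_on.chain (carrier L) (\<sqsubset>) C \<longleftrightarrow>
    C \<subseteq> carrier L \<and> (\<forall>x\<in>C. \<forall>y\<in>C. x \<sqsubseteq> y \<or> y \<sqsubseteq> x)"
proof -
  have "(\<sqsubset>)\<^sup>=\<^sup>= x y \<longleftrightarrow> x \<sqsubseteq> y" if "C \<subseteq> carrier L" "x \<in> C" for x y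
    using that le_refl[of x] unfolding sup_fun_def sup_bool_def lless_iff by blast
  then show ?thesis
    unfolding pred_on.chain_def by meson
qed

lemma chain_subset:
  "pred_on.chain (carrier L) (\<sqsubset>) C \<Longrightarrow> D \<subseteq> C \<Longrightarrow> pred_on.chain (carrier L) (\<sqsubset>) D"
  unfolding chain_iff by (meson subset_iff)

text \<open>The form in which maximality is applied: otherwise \<open>insert x C\<close> would be a
  larger chain.\<close>

lemma maxchain_comparable:
  assumes "pred_on.maxchain (carrier L) (\<sqsubset>) C" "x \<in> carrier L"
    and "\<And>z. z \<in> C \<Longrightarrow> z \<sqsubseteq> x \<or> x \<sqsubseteq> z"
  shows "x \<in> C"
proof (rule ccontr)
  assume "x \<notin> C"
  moreover have "pred_on.chain (carrier L) (\<sqsubset>) (insert x C)"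
    using assms unfolding pred_on.maxchain_def chain_iff by (simp add: le_refl) blast
  ultimately show False
    using assms(1) unfolding pred_on.maxchain_def by blast
qed

text \<open>Consecutive elements of a maximal chain form covers, so \<open>r x\<close> counts the
  members of \<open>C\<close> strictly below \<open>x\<close>; the \<open>+ 1\<close> is for the top
  itself.\<close>

lemma card_maxchain:
  fixes r :: "'a \<Rightarrow> 'n::semiring_1"
  assumes r: "is_rank_function L r" and C: "pred_on.maxchain (carrier L) (\<sqsubset>) C"
  shows "of_nat (card C) = r \<top> + 1"
proof -
  have CL: "C \<subseteq> carrier L"
    and tot: "\<And>x y. x \<in> C \<Longrightarrow> y \<in> C \<Longrightarrow> x \<sqsubseteq> y \<or> y \<sqsubseteq> x"
    using chain_iff[THEN iffD1, OF pred_on.maxchain_def[THEN iffD1, THEN conjunct1, OF C]] by blast+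
  have fin: "finite C"
    using CL finite_carrier finite_subset by blast
  have bot: "\<bottom> \<in> C"
    by (rule maxchain_comparable[OF C bottom_closed]) (simp add: bottom_lower subsetD[OF CL])
  have top: "\<top> \<in> C"
    by (rule maxchain_comparable[OF C top_closed]) (simp add: top_higher subsetD[OF CL])
  have below: "of_nat (card {z \<in> C. z \<sqsubset> x}) = r x" if "x \<in> C" for x
    using subsetD[OF CL that] that
  proof (induction x rule: below_induct)
    case (step x)
    show ?case
    proof (cases "x = \<bottom>")
      case True
      then have "{z \<in> C. z \<sqsubset> x} = {}"
        using CL bottom_lower bottom_closed lless_antisym[of _ \<bottom>] antisym[of _ \<bottom>]
        by (auto simp: lless_iff)
      then show ?thesis
        using r True by (simp only: is_rank_function_def card.empty of_nat_0)
    next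
      case False
      then have "\<bottom> \<in> {z \<in> C. z \<sqsubset> x}"
        using bot bottom_lower step.hyps lless_iff by auto
      moreover have "{z \<in> C. z \<sqsubset> x} \<subseteq> carrier L"
        using CL by blast
      ultimately obtain y where "y \<in> {z \<in> C. z \<sqsubset> x}"
        and "\<And>z. z \<in> {z \<in> C. z \<sqsubset> x} \<Longrightarrow> \<not> y \<sqsubset> z"
        using maximal_exists by (metis (no_types, lifting) empty_iff)
      then have y: "y \<in> C" "y \<sqsubset> x"
        and ymax: "\<And>z. z \<in> C \<Longrightarrow> z \<sqsubset> x \<Longrightarrow> \<not> y \<sqsubset> z"
        by blast+
      have yL: "y \<in> carrier L"
        using y CL by blast
      \<comment> \<open>\<open>y\<close> is the immediate predecessor of \<open>x\<close> within
        \<open>C\<close>.\<close>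
      have dich: "z \<sqsubseteq> y \<or> x \<sqsubseteq> z" if "z \<in> C" for z
        using ymax[OF that] tot[OF that y(1)] tot[OF that step.prems] unfolding lless_iff by blast
      have "covers L y x"
        unfolding covers_def
      proof (intro conjI notI; (elim bexE conjE)?)
        fix z assume z: "z \<in> carrier L" "y \<sqsubset> z" "z \<sqsubset> x"
        \<comment> \<open>By \<open>dich\<close>, an element between \<open>y\<close> and
          \<open>x\<close> is comparable with all of \<open>C\<close>; maximality then puts it in
          \<open>C\<close>, against the choice of \<open>y\<close>.\<close>
        have "z \<in> C"
        proof (rule maxchain_comparable[OF C z(1)])
          fix w assume w: "w \<in> C"
          then have "w \<in> carrier L" using CL by blast
          then show "w \<sqsubseteq> z \<or> z \<sqsubseteq> w"
            using dich[OF w] z yL step.hyps le_trans[of w y z] le_trans[of z x w]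
            by (auto simp: lless_iff)
        qed
        then show False
          using ymax z by blast
      qed (use y yL step.hyps in auto)
      then have "r x = r y + 1"
        using r unfolding is_rank_function_def by blast
      moreover have "{z \<in> C. z \<sqsubset> x} = insert y {z \<in> C. z \<sqsubset> y}"
      proof (intro equalityI subsetI)
        fix z assume "z \<in> {z \<in> C. z \<sqsubset> x}"
        then show "z \<in> insert y {z \<in> C. z \<sqsubset> y}"
          using dich[of z] CL step.hyps antisym[of x z] by (auto simp: lless_iff)
      next
        fix z assume "z \<in> insert y {z \<in> C. z \<sqsubset> y}"
        then show "z \<in> {z \<in> C. z \<sqsubset> x}"
          using y yL CL step.hyps lless_trans[of z y x] by (auto simp: lless_iff)
      qed
      then have "card {z \<in> C. z \<sqsubset> x} = Suc (card {z \<in> C. z \<sqsubset> y})"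
        using fin by (simp add: lless_iff)
      ultimately show ?thesis
        using step.IH[OF yL y(2,1)] by (simp add: add.commute)
    qed
  qed
  have "C = insert \<top> {z \<in> C. z \<sqsubset> \<top>}"
    using top top_higher CL by (auto simp: lless_iff)
  then have "card C = Suc (card {z \<in> C. z \<sqsubset> \<top>})"
    using fin card_insert_disjoint[of "{z \<in> C. z \<sqsubset> \<top>}" \<top>] by (simp add: lless_iff)
  then show ?thesis
    using below[OF top] by (simp add: add.commute)
qed

text \<open>All sizes are tied to the same value at the top, and characteristic zero makes
  \<open>of_nat\<close> injective. The value type is generic because \<open>quiltrank\<close> is
  integer-valued.\<close>

lemma ranked_if_rank_function:
  fixes r :: "'a \<Rightarrow> 'n::{semiring_1, semiring_char_0}"
  assumes "is_rank_function L r"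
  shows "ranked L"
  unfolding ranked_def
proof (intro allI impI)
  fix C D
  assume "pred_on.maxchain (carrier L) (\<sqsubset>) C" "pred_on.maxchain (carrier L) (\<sqsubset>) D"
  then have "(of_nat (card C) :: 'n) = of_nat (card D)"
    using card_maxchain[OF assms] by simp
  then show "card C = card D"
    by (simp only: of_nat_eq_iff)
qed

end

section \<open>Existence of the rank function on a ranked poset\<close>

sublocale finite_bounded_ranked_poset \<subseteq> finite_bounded_poset
  by unfold_locales (rule finite_carrier)

context finite_bounded_ranked_poset
begin

definition chains_below :: "'a \<Rightarrow> 'a set set"
  where "chains_below x = {C. pred_on.chain (carrier L) (\<sqsubset>) C \<and> (\<forall>z\<in>C. z \<sqsubset> x)}"

definition chains_above :: "'a \<Rightarrow> 'a set set"
  where "chains_above x = {C. pred_on.chain (carrier L) (\<sqsubset>) C \<and> (\<forall>z\<in>C. x \<sqsubset> z)}"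

text \<open>The candidate for \<open>rank\<close>. Chains strictly below \<open>x\<close> are
  measured, so that the bottom gets 0 from the empty chain.\<close>

definition height :: "'a \<Rightarrow> nat"
  where "height x = Max (card ` chains_below x)"

lemma chain_finite: "pred_on.chain (carrier L) (\<sqsubset>) C \<Longrightarrow> finite C"
  using finite_subset[OF _ finite_carrier] by (simp add: chain_iff)

lemma finite_chains: "finite (chains_below x)" "finite (chains_above x)"
  unfolding chains_below_def chains_above_def
  by (rule finite_subset[of _ "Pow (carrier L)"]; use finite_carrier in \<open>auto simp: chain_iff\<close>)+

lemma empty_in_chains: "{} \<in> chains_below x" "{} \<in> chains_above x"
  by (auto simp: chains_below_def chains_above_def chain_iff)

lemma height_attained:
  obtains C where "C \<in> chains_below x" "card C = height x"
    "\<And>C'. C' \<in> chains_below x \<Longrightarrow> card C' \<le> card C"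
proof -
  have "height x \<in> card ` chains_below x"
    unfolding height_def using finite_chains empty_in_chains by (intro Max_in) blast+
  then obtain C where "C \<in> chains_below x" "card C = height x"
    by force
  moreover have "card C' \<le> height x" if "C' \<in> chains_below x" for C'
    unfolding height_def using that finite_chains by simp
  ultimately show thesis
    using that by simp
qed

text \<open>Allowing both \<open>x = y\<close> and \<open>covers L x y\<close> yields maximal chains
  through a point and through an edge; \<open>height_covers\<close> compares one of each.\<close>

lemma maxchain_through:
  assumes xy: "x \<in> carrier L" "x = y \<or> covers L x y"
    and C: "C \<in> chains_below x" "\<And>C'. C' \<in> chains_below x \<Longrightarrow> card C' \<le> card C"
    and D: "D \<in> chains_above y" "\<And>D'. D' \<in> chains_above y \<Longrightarrow> card D' \<le> card D"
  shows "pred_on.maxchain (carrier L) (\<sqsubset>) (C \<union> {x, y} \<union> D)"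
    and "card (C \<union> {x, y} \<union> D) = card C + card {x, y} + card D"
proof -
  have y: "y \<in> carrier L" "x \<sqsubseteq> y"
    using xy coversD by auto
  have Cch: "C \<subseteq> carrier L" "\<forall>a\<in>C. \<forall>b\<in>C. a \<sqsubseteq> b \<or> b \<sqsubseteq> a" "\<forall>a\<in>C. a \<sqsubset> x" "finite C"
    using C(1) chain_finite by (auto simp: chains_below_def chain_iff)
  have Dch: "D \<subseteq> carrier L" "\<forall>a\<in>D. \<forall>b\<in>D. a \<sqsubseteq> b \<or> b \<sqsubseteq> a" "\<forall>a\<in>D. y \<sqsubset> a" "finite D"
    using D(1) chain_finite by (auto simp: chains_above_def chain_iff)
  have Cx: "a \<sqsubseteq> x" "a \<noteq> x" "a \<in> carrier L" if "a \<in> C" for a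
    using that Cch by (auto simp: lless_iff)
  have yD: "y \<sqsubseteq> b" "y \<noteq> b" "b \<in> carrier L" if "b \<in> D" for b
    using that Dch by (auto simp: lless_iff)
  have Cy: "a \<sqsubseteq> y" if "a \<in> C" for a
    by (rule le_trans[OF Cx(1)[OF that] y(2) Cx(3)[OF that] xy(1) y(1)])
  have xD: "x \<sqsubseteq> b" if "b \<in> D" for b
    by (rule le_trans[OF y(2) yD(1)[OF that] xy(1) y(1) yD(3)[OF that]])
  have CD: "a \<sqsubseteq> b" if "a \<in> C" "b \<in> D" for a b
    by (rule le_trans[OF Cy yD(1) _ y(1)]) (use that Cx yD in simp_all)
  have ch: "pred_on.chain (carrier L) (\<sqsubset>) (C \<union> {x, y} \<union> D)"
    unfolding chain_iff using Cch(1,2) Dch(1,2)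
    by (simp add: ball_Un Cx Cy xD yD CD xy(1) y)
  show "pred_on.maxchain (carrier L) (\<sqsubset>) (C \<union> {x, y} \<union> D)"
    unfolding pred_on.maxchain_def
  proof (intro conjI notI ch)
    assume "\<exists>S. pred_on.chain (carrier L) (\<sqsubset>) S \<and> C \<union> {x, y} \<union> D \<subset> S"
    then obtain S z where S: "pred_on.chain (carrier L) (\<sqsubset>) S" "C \<union> {x, y} \<union> D \<subseteq> S"
      and z: "z \<in> S" "z \<notin> C" "z \<noteq> x" "z \<noteq> y" "z \<notin> D"
      by blast
    have zL: "z \<in> carrier L"
      using S z by (auto simp: chain_iff)
    have "pred_on.chain (carrier L) (\<sqsubset>) (insert z C)" "pred_on.chain (carrier L) (\<sqsubset>) (insert z D)"
      by (rule chain_subset[OF S(1)]; use S(2) z(1) in blast)+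
    then have "z \<sqsubset> x \<Longrightarrow> insert z C \<in> chains_below x" "y \<sqsubset> z \<Longrightarrow> insert z D \<in> chains_above y"
      using Cch Dch by (auto simp: chains_below_def chains_above_def)
    \<comment> \<open>Below \<open>x\<close> the element \<open>z\<close> would enlarge
      \<open>C\<close>, above \<open>y\<close> it would enlarge \<open>D\<close>; comparability then
      leaves only the gap between \<open>x\<close> and \<open>y\<close>.\<close>
    then have "\<not> z \<sqsubset> x" "\<not> y \<sqsubset> z"
      using C(2) D(2) z Cch(4) Dch(4) by fastforce+
    moreover have "z \<sqsubseteq> x \<or> x \<sqsubseteq> z" "z \<sqsubseteq> y \<or> y \<sqsubseteq> z"
      using S z by (auto simp: chain_iff)
    ultimately have "x \<sqsubset> z" "z \<sqsubset> y"
      using z by (auto simp: lless_iff)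
    then show False
      using xy zL antisym[of x z] by (auto simp: covers_def lless_iff)
  qed
  have "C \<inter> {x, y} = {}"
    using Cx Cy antisym[OF _ y(2) y(1) xy(1)] by auto
  moreover have "(C \<union> {x, y}) \<inter> D = {}"
  proof -
    have False if "a \<in> D" "a \<sqsubseteq> y" for a
      using antisym[OF that(2) yD(1)[OF that(1)]] yD[OF that(1)] y(1) by simp
    then show ?thesis
      using Cy y le_refl[OF y(1)] by auto
  qed
  ultimately show "card (C \<union> {x, y} \<union> D) = card C + card {x, y} + card D"
    using Cch(4) Dch(4) by (subst card_Un_disjoint; simp add: card_Un_disjoint del: Un_insert_right)
qed

text \<open>Two maximal chains share the upper part \<open>D\<close>: one passes through
  \<open>x\<close> and \<open>y\<close> on top of a longest chain below \<open>x\<close>, the other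
  through \<open>y\<close> alone on top of a longest chain below \<open>y\<close>. Equal sizes give
  \<open>height x + 2 = height y + 1\<close>.\<close>

lemma height_covers:
  assumes "covers L x y"
  shows "height y = height x + 1"
proof -
  obtain C where C: "C \<in> chains_below x" "card C = height x"
    "\<And>C'. C' \<in> chains_below x \<Longrightarrow> card C' \<le> card C"
    using height_attained by metis
  obtain C' where C': "C' \<in> chains_below y" "card C' = height y"
    "\<And>C. C \<in> chains_below y \<Longrightarrow> card C \<le> card C'"
    using height_attained by metis
  have "Max (card ` chains_above y) \<in> card ` chains_above y"
    using finite_chains empty_in_chains by (intro Max_in) blast+
  then obtain D where "D \<in> chains_above y" "card D = Max (card ` chains_above y)"
    by force
  then have D: "D \<in> chains_above y" "\<And>D'. D' \<in> chains_above y \<Longrightarrow> card D' \<le> card D"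
    using finite_chains by simp_all
  have "card (C \<union> {x, y} \<union> D) = card (C' \<union> {y, y} \<union> D)"
    using ranked maxchain_through(1)[of x y C D] maxchain_through(1)[of y y C' D] C C' D
      assms coversD unfolding ranked_def by blast
  then have "card C + card {x, y} + card D = card C' + card {y, y} + card D"
    using maxchain_through(2)[of x y C D] maxchain_through(2)[of y y C' D] C C' D
      assms coversD by metis
  then show ?thesis
    using C(2) C'(2) coversD(5)[OF assms] by simp
qed

lemma height_bottom: "height \<bottom> = 0"
proof -
  have "chains_below \<bottom> = {{}}"
    using antisym[OF _ bottom_lower bottom_closed] empty_in_chains
    by (fastforce simp: chains_below_def chain_iff lless_iff)
  then show ?thesis
    by (simp add: height_def)
qed

lemma is_rank_function_rank: "is_rank_function L (rank L)"
proof -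
  let ?P = "\<lambda>r :: 'a \<Rightarrow> nat. r \<in> extensional (carrier L) \<and> is_rank_function L r"
  have "?P (restrict height (carrier L))"
    using height_covers height_bottom coversD by (auto simp: is_rank_function_def)
  moreover have "r = s" if "?P r" "?P s" for r s
    using that rank_function_unique[of r s] by (auto intro: extensionalityI)
  ultimately have "?P (rank L)"
    unfolding rank_def by (intro theI'[of ?P]) blast
  then show ?thesis ..
qed

lemma rank_bottom: "rank L \<bottom> = 0"
  and rank_covers: "covers L x y \<Longrightarrow> rank L y = rank L x + 1"
  using is_rank_function_rank by (auto simp: is_rank_function_def)

text \<open>Along each cover the rank rises by exactly one and \<open>g\<close> by at most one. The
  second bound is additive to avoid truncated subtraction.\<close>

lemma unit_step_bounds:
  fixes g :: "'a \<Rightarrow> nat"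
  assumes "\<And>x y. covers L x y \<Longrightarrow> g y \<in> {g x, g x + 1}"
    and "x \<in> carrier L" "y \<in> carrier L" "x \<sqsubseteq> y"
  shows "g x \<le> g y" "g y + rank L x \<le> g x + rank L y"
proof -
  have "g x \<le> g y \<and> g y + rank L x \<le> g x + rank L y"
    using assms(2-4)
    by (induction y rule: cover_induct) (use assms(1) rank_covers in \<open>fastforce+\<close>)
  then show "g x \<le> g y" "g y + rank L x \<le> g x + rank L y"
    by auto
qed

lemma rank_mono: "x \<in> carrier L \<Longrightarrow> y \<in> carrier L \<Longrightarrow> x \<sqsubseteq> y \<Longrightarrow> rank L x \<le> rank L y"
  by (rule unit_step_bounds(1)) (simp_all add: rank_covers)

lemma rank_le_poset_rank: "x \<in> carrier L \<Longrightarrow> rank L x \<le> poset_rank L"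
  unfolding poset_rank_def by (simp add: rank_mono top_higher)

end

section \<open>Quilts as maps with unit steps in each coordinate\<close>

lemma quilt_poset_simps [simp]:
  "carrier (quilt_poset P Q) = quilts P Q"
  "eq (quilt_poset P Q) = (=)"
  "f \<sqsubseteq>\<^bsub>quilt_poset P Q\<^esub> g \<longleftrightarrow> (\<forall>x\<in>carrier P. \<forall>y\<in>carrier Q. f (x, y) \<le> g (x, y))"
  by (simp_all add: quilt_poset_def)

locale two_ranked_posets =
  P: finite_bounded_ranked_poset P + Q: finite_bounded_ranked_poset Q
  for P :: "('a, 'm) gorder_scheme" and Q :: "('b, 'n) gorder_scheme"
begin

lemma carrier_prod_poset [simp]: "carrier (prod_poset P Q) = carrier P \<times> carrier Q"
  by (simp add: prod_poset_def)

lemma lless_prod_iff: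
  "(x, y) \<sqsubset>\<^bsub>prod_poset P Q\<^esub> (x', y') \<longleftrightarrow>
    x \<sqsubseteq>\<^bsub>P\<^esub> x' \<and> y \<sqsubseteq>\<^bsub>Q\<^esub> y' \<and> (x \<noteq> x' \<or> y \<noteq> y')"
  by (auto simp: lless_def prod_poset_def)

lemma covers_prod_iff:
  "covers (prod_poset P Q) (x, y) (x', y') \<longleftrightarrow>
    covers P x x' \<and> y = y' \<and> y \<in> carrier Q \<or> x = x' \<and> x \<in> carrier P \<and> covers Q y y'"
  (is "?l \<longleftrightarrow> ?r")
proof
  assume ?l
  then have "(x \<in> carrier P \<and> y \<in> carrier Q) \<and> (x' \<in> carrier P \<and> y' \<in> carrier Q) \<and>
      (x \<sqsubseteq>\<^bsub>P\<^esub> x' \<and> y \<sqsubseteq>\<^bsub>Q\<^esub> y' \<and> (x \<noteq> x' \<or> y \<noteq> y')) \<and>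
      (\<forall>u\<in>carrier P. \<forall>v\<in>carrier Q. \<not> ((x \<sqsubseteq>\<^bsub>P\<^esub> u \<and> y \<sqsubseteq>\<^bsub>Q\<^esub> v \<and> (x \<noteq> u \<or> y \<noteq> v)) \<and>
        (u \<sqsubseteq>\<^bsub>P\<^esub> x' \<and> v \<sqsubseteq>\<^bsub>Q\<^esub> y' \<and> (u \<noteq> x' \<or> v \<noteq> y'))))"
    by (simp add: covers_def lless_prod_iff)
  then have c: "x \<in> carrier P" "y \<in> carrier Q" "x' \<in> carrier P" "y' \<in> carrier Q"
    and le: "x \<sqsubseteq>\<^bsub>P\<^esub> x'" "y \<sqsubseteq>\<^bsub>Q\<^esub> y'" and ne: "x \<noteq> x' \<or> y \<noteq> y'"
    and no: "\<And>u v. u \<in> carrier P \<Longrightarrow> v \<in> carrier Q \<Longrightarrow> x \<sqsubseteq>\<^bsub>P\<^esub> u \<Longrightarrow> y \<sqsubseteq>\<^bsub>Q\<^esub> v \<Longrightarrow> x \<noteq> u \<or> y \<noteq> v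
      \<Longrightarrow> u \<sqsubseteq>\<^bsub>P\<^esub> x' \<Longrightarrow> v \<sqsubseteq>\<^bsub>Q\<^esub> y' \<Longrightarrow> u \<noteq> x' \<or> v \<noteq> y' \<Longrightarrow> False"
    by metis+
  \<comment> \<open>Otherwise the corner \<open>(x', y)\<close> lies strictly between the two
    points.\<close>
  have "x = x' \<or> y = y'"
    using no[of x' y] c le P.le_refl[of x'] Q.le_refl[of y] by blast
  then show ?r
  proof
    assume x: "x = x'"
    then have "covers Q y y'"
      using c le ne no[of x] P.le_refl[of x] by (auto simp: covers_def Q.lless_iff)
    then show ?r
      using x c by simp
  next
    assume y: "y = y'"
    then have "covers P x x'" if "x \<noteq> x'"
      using that c le no[of _ y] Q.le_refl[of y] by (auto simp: covers_def P.lless_iff)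
    moreover have "x \<noteq> x'"
      using y ne by simp
    ultimately show ?r
      using y c by simp
  qed
next
  assume ?r
  then show ?l
  proof (elim disjE conjE)
    assume xx': "covers P x x'" and y: "y = y'" "y \<in> carrier Q"
    have "v = y" if "v \<in> carrier Q" "y \<sqsubseteq>\<^bsub>Q\<^esub> v" "v \<sqsubseteq>\<^bsub>Q\<^esub> y" for v
      using that y Q.antisym by simp
    then show ?l
      using xx' y Q.le_refl[of y] unfolding covers_def
      by (auto simp: lless_prod_iff P.lless_iff)
  next
    assume yy': "covers Q y y'" and x: "x = x'" "x \<in> carrier P"
    have "u = x" if "u \<in> carrier P" "x \<sqsubseteq>\<^bsub>P\<^esub> u" "u \<sqsubseteq>\<^bsub>P\<^esub> x" for u
      using that x P.antisym by simp
    then show ?l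
      using yy' x P.le_refl[of x] unfolding covers_def
      by (auto simp: lless_prod_iff Q.lless_iff)
  qed
qed

text \<open>With one coordinate fixed, a quilt becomes a unit-step function of the other, to which
  \<open>unit_step_bounds\<close> applies.\<close>

lemma quilts_iff:
  "f \<in> quilts P Q \<longleftrightarrow>
    f \<in> extensional (carrier P \<times> carrier Q) \<and>
    (\<forall>y\<in>carrier Q. f (\<bottom>\<^bsub>P\<^esub>, y) = 0) \<and> (\<forall>x\<in>carrier P. f (x, \<bottom>\<^bsub>Q\<^esub>) = 0) \<and>
    f (\<top>\<^bsub>P\<^esub>, \<top>\<^bsub>Q\<^esub>) = min (poset_rank P) (poset_rank Q) \<and>
    (\<forall>x x'. covers P x x' \<longrightarrow> (\<forall>y\<in>carrier Q. f (x', y) \<in> {f (x, y), f (x, y) + 1})) \<and>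
    (\<forall>y y'. covers Q y y' \<longrightarrow> (\<forall>x\<in>carrier P. f (x, y') \<in> {f (x, y), f (x, y) + 1}))"
proof -
  have "(\<forall>x\<in>carrier P. \<forall>y\<in>carrier Q. x = \<bottom>\<^bsub>P\<^esub> \<or> y = \<bottom>\<^bsub>Q\<^esub> \<longrightarrow> f (x, y) = 0) \<longleftrightarrow>
      (\<forall>y\<in>carrier Q. f (\<bottom>\<^bsub>P\<^esub>, y) = 0) \<and> (\<forall>x\<in>carrier P. f (x, \<bottom>\<^bsub>Q\<^esub>) = 0)"
    using P.bottom_closed Q.bottom_closed by auto
  moreover have "(\<forall>x y x' y'. covers (prod_poset P Q) (x, y) (x', y')
        \<longrightarrow> f (x', y') \<in> {f (x, y), f (x, y) + 1}) \<longleftrightarrow>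
      (\<forall>x x'. covers P x x' \<longrightarrow> (\<forall>y\<in>carrier Q. f (x', y) \<in> {f (x, y), f (x, y) + 1})) \<and>
      (\<forall>y y'. covers Q y y' \<longrightarrow> (\<forall>x\<in>carrier P. f (x, y') \<in> {f (x, y), f (x, y) + 1}))"
    unfolding covers_prod_iff by blast
  ultimately show ?thesis
    by (simp add: quilts_def PiE_def)
qed

lemma quilt_bounds:
  assumes "f \<in> quilts P Q" "x \<in> carrier P" "y \<in> carrier Q"
  shows "f (x, y) \<le> rank P x" "f (x, y) \<le> rank Q y"
    "rank P x + rank Q y \<le> f (x, y) + max (poset_rank P) (poset_rank Q)"
proof -
  note [simp] = P.bottom_lower P.top_higher Q.bottom_lower Q.top_higher
  have sP: "f (x, y) \<in> {f (x', y), f (x', y) + 1}" if "covers P x' x" "y \<in> carrier Q" for x x' y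
    using assms(1) that unfolding quilts_iff by blast
  have sQ: "f (x, y) \<in> {f (x, y'), f (x, y') + 1}" if "covers Q y' y" "x \<in> carrier P" for x y y'
    using assms(1) that unfolding quilts_iff by blast
  have zero: "f (\<bottom>\<^bsub>P\<^esub>, y) = 0" "f (x, \<bottom>\<^bsub>Q\<^esub>) = 0"
    using assms unfolding quilts_iff by blast+
  show "f (x, y) \<le> rank P x"
    using P.unit_step_bounds(2)[of "\<lambda>x. f (x, y)" "\<bottom>\<^bsub>P\<^esub>" x] sP assms zero
    by (simp add: P.rank_bottom)
  show "f (x, y) \<le> rank Q y"
    using Q.unit_step_bounds(2)[of "\<lambda>y. f (x, y)" "\<bottom>\<^bsub>Q\<^esub>" y] sQ assms zero
    by (simp add: Q.rank_bottom)
  \<comment> \<open>The climb to the top, where the value is prescribed, goes first in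
    \<open>P\<close> and then in \<open>Q\<close>.\<close>
  have "f (\<top>\<^bsub>P\<^esub>, y) + rank P x \<le> f (x, y) + poset_rank P"
    using P.unit_step_bounds(2)[of "\<lambda>x. f (x, y)" x "\<top>\<^bsub>P\<^esub>"] sP assms
    by (simp add: poset_rank_def)
  moreover have "f (\<top>\<^bsub>P\<^esub>, \<top>\<^bsub>Q\<^esub>) + rank Q y \<le> f (\<top>\<^bsub>P\<^esub>, y) + poset_rank Q"
    using Q.unit_step_bounds(2)[of "\<lambda>y. f (\<top>\<^bsub>P\<^esub>, y)" y "\<top>\<^bsub>Q\<^esub>"] sQ assms
    by (simp add: poset_rank_def)
  moreover have "f (\<top>\<^bsub>P\<^esub>, \<top>\<^bsub>Q\<^esub>) = min (poset_rank P) (poset_rank Q)"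
    using assms unfolding quilts_iff by blast
  ultimately show "rank P x + rank Q y \<le> f (x, y) + max (poset_rank P) (poset_rank Q)"
    by linarith
qed

section \<open>The least and the greatest quilt\<close>

lemma least_quilt_in_quilts: "least_quilt P Q \<in> quilts P Q"
  unfolding quilts_iff
proof (intro conjI allI impI ballI)
  show "least_quilt P Q (\<bottom>\<^bsub>P\<^esub>, y) = 0" if "y \<in> carrier Q" for y
    using that Q.rank_le_poset_rank[OF that] by (simp add: least_quilt_def P.rank_bottom)
  show "least_quilt P Q (x, \<bottom>\<^bsub>Q\<^esub>) = 0" if "x \<in> carrier P" for x
    using that P.rank_le_poset_rank[OF that] by (simp add: least_quilt_def Q.rank_bottom)
  show "least_quilt P Q (\<top>\<^bsub>P\<^esub>, \<top>\<^bsub>Q\<^esub>) = min (poset_rank P) (poset_rank Q)"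
    by (simp add: least_quilt_def flip: poset_rank_def)
  \<comment> \<open>Adding one to an integer raises its truncation at 0 by 0 or 1.\<close>
  show "least_quilt P Q (x', y) \<in> {least_quilt P Q (x, y), least_quilt P Q (x, y) + 1}"
    if "covers P x x'" "y \<in> carrier Q" for x x' y
    using that P.coversD(1,2)[OF that(1)] P.rank_covers[OF that(1)]
    by (simp add: least_quilt_def) linarith
  show "least_quilt P Q (x, y') \<in> {least_quilt P Q (x, y), least_quilt P Q (x, y) + 1}"
    if "covers Q y y'" "x \<in> carrier P" for x y y'
    using that Q.coversD(1,2)[OF that(1)] Q.rank_covers[OF that(1)]
    by (simp add: least_quilt_def) linarith
qed (simp add: least_quilt_def)

lemma greatest_quilt_in_quilts: "greatest_quilt P Q \<in> quilts P Q"
  unfolding quilts_iff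
proof (intro conjI allI impI ballI)
  show "greatest_quilt P Q (x', y) \<in> {greatest_quilt P Q (x, y), greatest_quilt P Q (x, y) + 1}"
    if "covers P x x'" "y \<in> carrier Q" for x x' y
    using that P.coversD(1,2)[OF that(1)] P.rank_covers[OF that(1)]
    by (simp add: greatest_quilt_def) linarith
  show "greatest_quilt P Q (x, y') \<in> {greatest_quilt P Q (x, y), greatest_quilt P Q (x, y) + 1}"
    if "covers Q y y'" "x \<in> carrier P" for x y y'
    using that Q.coversD(1,2)[OF that(1)] Q.rank_covers[OF that(1)]
    by (simp add: greatest_quilt_def) linarith
qed (simp_all add: greatest_quilt_def P.rank_bottom Q.rank_bottom flip: poset_rank_def)

lemma least_least_quilt: "least (quilt_poset P Q) (least_quilt P Q) (quilts P Q)"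
proof -
  have "least_quilt P Q (x, y) \<le> f (x, y)" if "f \<in> quilts P Q" "x \<in> carrier P" "y \<in> carrier Q" for f x y
    using quilt_bounds(3)[OF that] that(2,3) by (simp add: least_quilt_def)
  then show ?thesis
    using least_quilt_in_quilts by (simp add: least_def)
qed

lemma greatest_greatest_quilt: "greatest (quilt_poset P Q) (greatest_quilt P Q) (quilts P Q)"
  using greatest_quilt_in_quilts quilt_bounds(1,2) by (simp add: greatest_def greatest_quilt_def)

lemma quilt_eqI:
  assumes "f \<in> quilts P Q" "g \<in> quilts P Q"
    and "\<And>x y. x \<in> carrier P \<Longrightarrow> y \<in> carrier Q \<Longrightarrow> f (x, y) = g (x, y)"
  shows "f = g"
  using assms unfolding quilts_iff by (intro extensionalityI[of f "carrier P \<times> carrier Q"]) auto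

lemma finite_quilts: "finite (quilts P Q)"
proof (rule finite_subset)
  show "quilts P Q \<subseteq> carrier P \<times> carrier Q \<rightarrow>\<^sub>E {..poset_rank P}"
  proof
    fix f assume f: "f \<in> quilts P Q"
    then have "f (x, y) \<le> poset_rank P" if "x \<in> carrier P" "y \<in> carrier Q" for x y
      using quilt_bounds(1)[OF f that] P.rank_le_poset_rank[OF that(1)] by linarith
    then show "f \<in> carrier P \<times> carrier Q \<rightarrow>\<^sub>E {..poset_rank P}"
      using f by (auto simp: quilts_iff PiE_def)
  qed
  show "finite (carrier P \<times> carrier Q \<rightarrow>\<^sub>E {..poset_rank P})"
    using P.finite_carrier Q.finite_carrier by (intro finite_PiE) auto
qed

sublocale quilts: finite_bounded_poset "quilt_poset P Q"
proof unfold_locales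
  fix f g
  assume "f \<in> carrier (quilt_poset P Q)" "g \<in> carrier (quilt_poset P Q)"
    "f \<sqsubseteq>\<^bsub>quilt_poset P Q\<^esub> g" "g \<sqsubseteq>\<^bsub>quilt_poset P Q\<^esub> f"
  then show "f .=\<^bsub>quilt_poset P Q\<^esub> g"
    using quilt_eqI by (simp add: le_antisym)
next
  show "\<exists>f. least (quilt_poset P Q) f (carrier (quilt_poset P Q))"
    using least_least_quilt by auto
  show "\<exists>f. greatest (quilt_poset P Q) f (carrier (quilt_poset P Q))"
    using greatest_greatest_quilt by auto
  fix f g h
  assume "f \<sqsubseteq>\<^bsub>quilt_poset P Q\<^esub> g" "g \<sqsubseteq>\<^bsub>quilt_poset P Q\<^esub> h"
  then show "f \<sqsubseteq>\<^bsub>quilt_poset P Q\<^esub> h"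
    using order.trans by (simp, blast)
qed (use finite_quilts in auto)

section \<open>The distributive lattice structure\<close>

definition quilt_max :: "('a \<times> 'b \<Rightarrow> nat) \<Rightarrow> ('a \<times> 'b \<Rightarrow> nat) \<Rightarrow> 'a \<times> 'b \<Rightarrow> nat"
  where "quilt_max f g = (\<lambda>p\<in>carrier P \<times> carrier Q. max (f p) (g p))"

definition quilt_min :: "('a \<times> 'b \<Rightarrow> nat) \<Rightarrow> ('a \<times> 'b \<Rightarrow> nat) \<Rightarrow> 'a \<times> 'b \<Rightarrow> nat"
  where "quilt_min f g = (\<lambda>p\<in>carrier P \<times> carrier Q. min (f p) (g p))"

text \<open>Integrality is essential: if \<open>a < c\<close> then
  \<open>b \<le> a + 1 \<le> c \<le> d\<close>, so the order of the two values cannot flip within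
  one step; if \<open>a = c\<close> both choices lie in the same pair.\<close>

lemma max_min_unit_step:
  fixes a b c d :: nat
  assumes "b \<in> {a, a + 1}" "d \<in> {c, c + 1}"
  shows "max b d \<in> {max a c, max a c + 1}" "min b d \<in> {min a c, min a c + 1}"
  using assms by auto

lemma quilt_max_min_closed:
  assumes "f \<in> quilts P Q" "g \<in> quilts P Q"
  shows "quilt_max f g \<in> quilts P Q" "quilt_min f g \<in> quilts P Q"
proof -
  have f: "covers P x x' \<Longrightarrow> y \<in> carrier Q \<Longrightarrow> f (x', y) \<in> {f (x, y), f (x, y) + 1}"
    and g: "covers P x x' \<Longrightarrow> y \<in> carrier Q \<Longrightarrow> g (x', y) \<in> {g (x, y), g (x, y) + 1}" for x x' y
    using assms unfolding quilts_iff by blast+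
  have f': "covers Q y y' \<Longrightarrow> x \<in> carrier P \<Longrightarrow> f (x, y') \<in> {f (x, y), f (x, y) + 1}"
    and g': "covers Q y y' \<Longrightarrow> x \<in> carrier P \<Longrightarrow> g (x, y') \<in> {g (x, y), g (x, y) + 1}" for x y y'
    using assms unfolding quilts_iff by blast+
  have bot: "\<forall>y\<in>carrier Q. f (\<bottom>\<^bsub>P\<^esub>, y) = 0 \<and> g (\<bottom>\<^bsub>P\<^esub>, y) = 0"
    "\<forall>x\<in>carrier P. f (x, \<bottom>\<^bsub>Q\<^esub>) = 0 \<and> g (x, \<bottom>\<^bsub>Q\<^esub>) = 0"
    and top: "f (\<top>\<^bsub>P\<^esub>, \<top>\<^bsub>Q\<^esub>) = min (poset_rank P) (poset_rank Q)"
      "g (\<top>\<^bsub>P\<^esub>, \<top>\<^bsub>Q\<^esub>) = min (poset_rank P) (poset_rank Q)"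
    using assms unfolding quilts_iff by blast+
  show "quilt_max f g \<in> quilts P Q"
    unfolding quilts_iff
  proof (intro conjI allI impI ballI)
    show "quilt_max f g (x', y) \<in> {quilt_max f g (x, y), quilt_max f g (x, y) + 1}"
      if "covers P x x'" "y \<in> carrier Q" for x x' y
      using max_min_unit_step(1)[OF f[OF that] g[OF that]] P.coversD(1,2)[OF that(1)] that(2)
      by (simp add: quilt_max_def)
    show "quilt_max f g (x, y') \<in> {quilt_max f g (x, y), quilt_max f g (x, y) + 1}"
      if "covers Q y y'" "x \<in> carrier P" for x y y'
      using max_min_unit_step(1)[OF f'[OF that] g'[OF that]] Q.coversD(1,2)[OF that(1)] that(2)
      by (simp add: quilt_max_def)
  qed (simp_all add: quilt_max_def bot top)
  show "quilt_min f g \<in> quilts P Q"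
    unfolding quilts_iff
  proof (intro conjI allI impI ballI)
    show "quilt_min f g (x', y) \<in> {quilt_min f g (x, y), quilt_min f g (x, y) + 1}"
      if "covers P x x'" "y \<in> carrier Q" for x x' y
      using max_min_unit_step(2)[OF f[OF that] g[OF that]] P.coversD(1,2)[OF that(1)] that(2)
      by (simp add: quilt_min_def)
    show "quilt_min f g (x, y') \<in> {quilt_min f g (x, y), quilt_min f g (x, y) + 1}"
      if "covers Q y y'" "x \<in> carrier P" for x y y'
      using max_min_unit_step(2)[OF f'[OF that] g'[OF that]] Q.coversD(1,2)[OF that(1)] that(2)
      by (simp add: quilt_min_def)
  qed (simp_all add: quilt_min_def bot top)
qed

lemma least_quilt_max:
  assumes "f \<in> quilts P Q" "g \<in> quilts P Q"
  shows "least (quilt_poset P Q) (quilt_max f g) (Upper (quilt_poset P Q) {f, g})"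
  using assms quilt_max_min_closed(1)[OF assms] by (auto simp: least_def Upper_def quilt_max_def)

lemma greatest_quilt_min:
  assumes "f \<in> quilts P Q" "g \<in> quilts P Q"
  shows "greatest (quilt_poset P Q) (quilt_min f g) (Lower (quilt_poset P Q) {f, g})"
  using assms quilt_max_min_closed(2)[OF assms] by (auto simp: greatest_def Lower_def quilt_min_def)

text \<open>\<open>join\<close> is a choice among least upper bounds, so identifying its value takes
  their uniqueness.\<close>

lemma join_quilt_poset:
  assumes "f \<in> quilts P Q" "g \<in> quilts P Q"
  shows "f \<squnion>\<^bsub>quilt_poset P Q\<^esub> g = quilt_max f g"
  unfolding join_def sup_def
  by (rule some_equality) (rule least_quilt_max[OF assms],
      rule quilts.least_unique[OF _ least_quilt_max[OF assms]])

lemma meet_quilt_poset: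
  assumes "f \<in> quilts P Q" "g \<in> quilts P Q"
  shows "f \<sqinter>\<^bsub>quilt_poset P Q\<^esub> g = quilt_min f g"
  unfolding meet_def inf_def
  by (rule some_equality) (rule greatest_quilt_min[OF assms],
      rule quilts.greatest_unique[OF _ greatest_quilt_min[OF assms]])

lemma distributive_lattice_quilts: "distributive_lattice (quilt_poset P Q)"
proof unfold_locales
  fix f g
  assume "f \<in> carrier (quilt_poset P Q)" "g \<in> carrier (quilt_poset P Q)"
  then show "\<exists>s. least (quilt_poset P Q) s (Upper (quilt_poset P Q) {f, g})"
    and "\<exists>s. greatest (quilt_poset P Q) s (Lower (quilt_poset P Q) {f, g})"
    using least_quilt_max[of f g] greatest_quilt_min[of f g] by auto
next
  fix f g h
  assume "f \<in> carrier (quilt_poset P Q)" "g \<in> carrier (quilt_poset P Q)"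
    "h \<in> carrier (quilt_poset P Q)"
  \<comment> \<open>Both operations act pointwise, which reduces distributivity to that of
    \<open>min\<close> over \<open>max\<close> on the naturals.\<close>
  moreover have "quilt_min f (quilt_max g h) = quilt_max (quilt_min f g) (quilt_min f h)"
    unfolding quilt_max_def quilt_min_def
    by (rule restrict_ext) (simp add: min_max_distrib2)
  ultimately show "f \<sqinter>\<^bsub>quilt_poset P Q\<^esub> (g \<squnion>\<^bsub>quilt_poset P Q\<^esub> h) =
      (f \<sqinter>\<^bsub>quilt_poset P Q\<^esub> g) \<squnion>\<^bsub>quilt_poset P Q\<^esub> (f \<sqinter>\<^bsub>quilt_poset P Q\<^esub> h)"
    by (simp add: join_quilt_poset meet_quilt_poset quilt_max_min_closed)
qed

section \<open>The rank function of the quilt poset\<close>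

text \<open>
  The point to increment is chosen among those with \<open>f < g\<close> so as to minimise \<open>f\<close> and, among these
  minimisers, to maximise the rank. A lower neighbour where \<open>f\<close> is smaller, or an upper neighbour
  where \<open>f\<close> has the same value, would again satisfy \<open>f < g\<close> and contradict the choice.
\<close>

lemma quilt_increment:
  assumes f: "f \<in> quilts P Q" and g: "g \<in> quilts P Q"
    and le: "f \<sqsubseteq>\<^bsub>quilt_poset P Q\<^esub> g" and ne: "f \<noteq> g"
  obtains x y where "x \<in> carrier P" "y \<in> carrier Q" "f (x, y) < g (x, y)"
    "f((x, y) := f (x, y) + 1) \<in> quilts P Q"
proof -
  define S where "S p \<longleftrightarrow> p \<in> carrier P \<times> carrier Q \<and> f p < g p" for p
  define rk where "rk p = rank P (fst p) + rank Q (snd p)" for p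
  have fP: "covers P x x' \<Longrightarrow> y \<in> carrier Q \<Longrightarrow> f (x', y) \<in> {f (x, y), f (x, y) + 1}"
    and gP: "covers P x x' \<Longrightarrow> y \<in> carrier Q \<Longrightarrow> g (x', y) \<in> {g (x, y), g (x, y) + 1}" for x x' y
    using f g unfolding quilts_iff by blast+
  have fQ: "covers Q y y' \<Longrightarrow> x \<in> carrier P \<Longrightarrow> f (x, y') \<in> {f (x, y), f (x, y) + 1}"
    and gQ: "covers Q y y' \<Longrightarrow> x \<in> carrier P \<Longrightarrow> g (x, y') \<in> {g (x, y), g (x, y) + 1}" for x y y'
    using f g unfolding quilts_iff by blast+
  obtain x y where "x \<in> carrier P" "y \<in> carrier Q" "f (x, y) \<noteq> g (x, y)"
    using quilt_eqI[OF f g] ne by blast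
  then have "S (x, y)"
    using le by (simp add: S_def le_neq_implies_less)
  then obtain p0 where p0: "S p0" "\<And>q. S q \<Longrightarrow> f p0 \<le> f q"
    using ex_has_least_nat[of S _ f] by blast
  \<comment> \<open>A bound on \<open>rk\<close> is needed for a greatest value among the minimisers
    to exist.\<close>
  have "rk q < poset_rank P + poset_rank Q + 1" if "S q" for q
    using that P.rank_le_poset_rank[of "fst q"] Q.rank_le_poset_rank[of "snd q"]
    by (auto simp: S_def rk_def)
  then obtain p where p: "S p" "f p = f p0" "\<And>q. S q \<Longrightarrow> f q = f p0 \<Longrightarrow> rk q \<le> rk p"
    using ex_has_greatest_nat[of "\<lambda>q. S q \<and> f q = f p0" p0 rk] p0(1) by blast
  obtain a b where ab: "p = (a, b)" "a \<in> carrier P" "b \<in> carrier Q" "f (a, b) < g (a, b)"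
    using p(1) by (cases p) (auto simp: S_def)
  have least: "f (a, b) \<le> f q" if "S q" for q
    using p0(2)[OF that] p(2) ab(1) by simp
  have highest: "rk q \<le> rk (a, b)" if "S q" "f q = f (a, b)" for q
    using p(2) p(3)[OF that(1)] that(2) ab(1) by simp
  \<comment> \<open>If \<open>f\<close> were smaller by one at \<open>(x, b)\<close>, then
    \<open>g (x, b) + 1 \<ge> g (a, b)\<close> would preserve \<open>f < g\<close> there and
    undercut the minimum.\<close>
  have downP: "f (x, b) = f (a, b)" if "covers P x a" for x
    using least[of "(x, b)"] fP[OF that ab(3)] gP[OF that ab(3)] ab P.coversD(1)[OF that]
    by (auto simp: S_def)
  have downQ: "f (a, y) = f (a, b)" if "covers Q y b" for y
    using least[of "(a, y)"] fQ[OF that ab(2)] gQ[OF that ab(2)] ab Q.coversD(1)[OF that]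
    by (auto simp: S_def)
  \<comment> \<open>If \<open>f\<close> were flat here,
    \<open>f (x, b) = f (a, b) < g (a, b) \<le> g (x, b)\<close> would give a minimiser of larger
    rank.\<close>
  have upP: "f (x, b) = f (a, b) + 1" if "covers P a x" for x
    using highest[of "(x, b)"] fP[OF that ab(3)] gP[OF that ab(3)] ab P.coversD(2)[OF that]
      P.rank_covers[OF that] by (auto simp: S_def rk_def)
  have upQ: "f (a, y) = f (a, b) + 1" if "covers Q b y" for y
    using highest[of "(a, y)"] fQ[OF that ab(2)] gQ[OF that ab(2)] ab Q.coversD(2)[OF that]
      Q.rank_covers[OF that] by (auto simp: S_def rk_def)
  let ?h = "f((a, b) := f (a, b) + 1)"
  have "?h \<in> quilts P Q"
    unfolding quilts_iff
  proof (intro conjI allI impI ballI)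
    show "?h \<in> extensional (carrier P \<times> carrier Q)"
      using f ab(2,3) by (auto simp: quilts_iff extensional_def)
    \<comment> \<open>\<open>f\<close> and \<open>g\<close> have the same prescribed values on the
      bottom edges and at the top, so they cannot differ there.\<close>
    have "a \<noteq> \<bottom>\<^bsub>P\<^esub>" "b \<noteq> \<bottom>\<^bsub>Q\<^esub>" and top: "(a, b) \<noteq> (\<top>\<^bsub>P\<^esub>, \<top>\<^bsub>Q\<^esub>)"
      using f g ab(2-4) unfolding quilts_iff by fastforce+
    then show "?h (\<bottom>\<^bsub>P\<^esub>, y) = 0" if "y \<in> carrier Q" for y
      using f that by (auto simp: quilts_iff)
    show "?h (x, \<bottom>\<^bsub>Q\<^esub>) = 0" if "x \<in> carrier P" for x
      using f that \<open>b \<noteq> \<bottom>\<^bsub>Q\<^esub>\<close> by (auto simp: quilts_iff)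
    show "?h (\<top>\<^bsub>P\<^esub>, \<top>\<^bsub>Q\<^esub>) = min (poset_rank P) (poset_rank Q)"
      using f top by (auto simp: quilts_iff)
    \<comment> \<open>Only covers with an end at \<open>(a, b)\<close> are affected: those arriving
      there were flat and now rise by one, those leaving it rose by one and are now flat.\<close>
    show "?h (x', y) \<in> {?h (x, y), ?h (x, y) + 1}" if "covers P x x'" "y \<in> carrier Q" for x x' y
      using fP[OF that] downP[of x] upP[of x'] that(1) P.coversD(5)[OF that(1)] by auto
    show "?h (x, y') \<in> {?h (x, y), ?h (x, y) + 1}" if "covers Q y y'" "x \<in> carrier P" for x y y'
      using fQ[OF that] downQ[of y] upQ[of y'] that(1) Q.coversD(5)[OF that(1)] by auto
  qed
  then show thesis
    using that ab by blast
qed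

lemma quiltrank_increment:
  assumes "x \<in> carrier P" "y \<in> carrier Q"
  shows "quiltrank P Q (f((x, y) := f (x, y) + 1)) = quiltrank P Q f + 1"
proof -
  let ?A = "carrier P \<times> carrier Q"
  have "(\<Sum>p\<in>?A. int ((f((x, y) := f (x, y) + 1)) p)) = (\<Sum>p\<in>?A. int (f p) + (if p = (x, y) then 1 else 0))"
    by (rule sum.cong) auto
  also have "\<dots> = (\<Sum>p\<in>?A. int (f p)) + 1"
    using assms P.finite_carrier Q.finite_carrier by (simp add: sum.distrib)
  finally have sum: "(\<Sum>p\<in>?A. int ((f((x, y) := f (x, y) + 1)) p)) = (\<Sum>p\<in>?A. int (f p)) + 1" .
  \<comment> \<open>Over the product the nested sums become single ones, and the sum of
    \<open>least_quilt\<close> is a constant that cancels.\<close>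
  have "quiltrank P Q h = (\<Sum>p\<in>?A. int (h p)) - (\<Sum>p\<in>?A. int (least_quilt P Q p))" for h
    by (simp add: quiltrank_def sum.cartesian_product')
  then show ?thesis
    using sum by simp
qed

lemma is_rank_function_quiltrank: "is_rank_function (quilt_poset P Q) (quiltrank P Q)"
  unfolding is_rank_function_def
proof (intro conjI allI impI)
  have "\<bottom>\<^bsub>quilt_poset P Q\<^esub> = least_quilt P Q"
    using quilts.least_unique[OF quilts.bottom_least] least_least_quilt by simp
  then show "quiltrank P Q \<bottom>\<^bsub>quilt_poset P Q\<^esub> = 0"
    by (simp add: quiltrank_def)
next
  fix f g
  assume cov: "covers (quilt_poset P Q) f g"
  then have fg: "f \<in> quilts P Q" "g \<in> quilts P Q" "f \<sqsubseteq>\<^bsub>quilt_poset P Q\<^esub> g" "f \<noteq> g"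
    using quilts.coversD[OF cov] by simp_all
  then obtain x y where xy: "x \<in> carrier P" "y \<in> carrier Q" "f (x, y) < g (x, y)"
    and h: "f((x, y) := f (x, y) + 1) \<in> quilts P Q"
    by (rule quilt_increment)
  let ?h = "f((x, y) := f (x, y) + 1)"
  have "f \<sqsubset>\<^bsub>quilt_poset P Q\<^esub> ?h"
    by (auto simp: quilts.lless_iff fun_eq_iff)
  moreover have "?h \<sqsubseteq>\<^bsub>quilt_poset P Q\<^esub> g"
    using fg(3) xy(3) by auto
  \<comment> \<open>As \<open>g\<close> covers \<open>f\<close>, a quilt strictly above
    \<open>f\<close> and at most \<open>g\<close> can only be \<open>g\<close>.\<close>
  ultimately have "?h = g"
    using cov h by (auto simp: covers_def quilts.lless_iff)
  then show "quiltrank P Q g = quiltrank P Q f + 1"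
    using quiltrank_increment[OF xy(1,2), of f] by simp
qed

lemma finite_bounded_ranked_poset_quilts: "finite_bounded_ranked_poset (quilt_poset P Q)"
  using quilts.ranked_if_rank_function[OF is_rank_function_quiltrank] quilts.finite_carrier
  by unfold_locales

end

theorem theorem3p14:
  fixes P :: "('a, 'm) gorder_scheme" and Q :: "('b, 'n) gorder_scheme"
  assumes "finite_bounded_ranked_poset P" and "finite_bounded_ranked_poset Q"
  shows "distributive_lattice (quilt_poset P Q) \<and>
    finite_bounded_ranked_poset (quilt_poset P Q) \<and>
    is_rank_function (quilt_poset P Q) (quiltrank P Q) \<and>
    least (quilt_poset P Q) (least_quilt P Q) (quilts P Q) \<and>
    greatest (quilt_poset P Q) (greatest_quilt P Q) (quilts P Q)"
proof -
  interpret two_ranked_posets P Q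
    using assms by (simp add: two_ranked_posets_def)
  show ?thesis
    using distributive_lattice_quilts finite_bounded_ranked_poset_quilts
      is_rank_function_quiltrank least_least_quilt greatest_greatest_quilt by blast
qed

end
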